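(* Let $G$ be a finite simple connected cubic bridgeless graph and let $L_8$ denote the ladder on $8$ vertices. There is a sequence $H_0,H_1,\ldots,H_k$ of bipartite graphs such that $H_0=L_8$, $H_i$ can be obtained from $H_{i-1}$ by a simple augmentation for each $i\in\{1,\ldots,k\}$, and $H_k$ is (up to isomorphism) the hexagon graph of $G$.
   Context: **Ladder.** $L_8$ is the cubic bipartite graph with vertices $a_i,b_i$ ($i\in\mathbb{Z}_4$) and edges $a_ia_{i+1}$, $b_ib_{i+1}$, $a_ib_i$ (the 3-cube graph). **Simple augmentations.** Let $H$ be a bipartite graph. Expansion: let $x$ be a vertex of $H$ of degree at least $4$ and let $N_1,N_2$ be a partition of $N_H(x)$ with $|N_1|,|N_2|\ge 2$. The expansion of $x$ to $x^1vx^2$ (where $x^1,v,x^2$ are new vertices) consists of deleting $x$, adding the path $x^1vx^2$, and joining every vertex of $N_1$ to $x^1$ and every vertex of $N_2$ to $x^2$. Type-1 augmentation: $H'$ is a bipartite graph obtained from $H$ by adding a new edge. Type-2 augmentation: for two vertices $x,w$ in the same partition class of $H$ with $x$ of degree at least $4$, $H'$ is obtained from $H$ by expanding $x$ to $x^1vx^2$ and adding the new edge $vw$. A simple augmentation is a type-1 or a type-2 augmentation. **Hexagon graph.** Let $G$ be a finite simple cubic graph with vertex set $V$ and edge set $E$. A hexagon graph $H$ of $G$ is built as follows. (1) Each $v\in V$ is replaced by a copy $h_v$ of $K_{3,3}$ (a "hexagon"), the $h_v$ being pairwise vertex disjoint, with $V(H)=\bigcup_{v\in V}V(h_v)$. (2)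 For each $v$, write $V(h_v)=\{v_i: i\in\mathbb{Z}_6\}$ and $E(h_v)=\{v_iv_{i+1},\,v_iv_{i+3}: i\in\mathbb{Z}_6\}$. To each neighbour $u$ of $v$ in $G$ assign an index $i_{v(u)}\in\{0,1,2\}\subset\mathbb{Z}_6$ so that the three neighbours of $v$ get pairwise distinct indices. (3) Let $X=\bigcup_{v\in V}\{v_0,v_2,v_4\}$ and $Y=\bigcup_{v\in V}\{v_1,v_3,v_5\}$. Each edge $uv\in E$ is replaced by two vertex disjoint edges $e_{uv},e'_{uv}$: if $v_{i_{v(u)}}$ and $u_{i_{u(v)}}$ both belong to $X$ or both belong to $Y$, then $e_{uv}=v_{i_{v(u)}}u_{i_{u(v)}+3}$ and $e'_{uv}=v_{i_{v(u)}+3}u_{i_{u(v)}}$; otherwise $e_{uv}=v_{i_{v(u)}}u_{i_{u(v)}}$ and $e'_{uv}=v_{i_{v(u)}+3}u_{i_{u(v)}+3}$. Finally $E(H)=\bigcup_{v\in V}E(h_v)\cup\{e_{uv},e'_{uv}:uv\in E\}$. All hexagon graphs of $G$ are isomorphic, so one speaks of the hexagon graph of $G$. *)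

theory Defs
  imports Main
begin

record 'a ugraph =
  uverts :: "'a set"
  uedges :: "'a set set"

definition simple_graph :: "'a ugraph \<Rightarrow> bool" where
  "simple_graph G \<longleftrightarrow> finite (uverts G) \<and> (\<forall>e\<in>uedges G. e \<subseteq> uverts G \<and> card e = 2)"

definition nbrs :: "'a ugraph \<Rightarrow> 'a \<Rightarrow> 'a set" where
  "nbrs G v = {u. {v, u} \<in> uedges G}"

definition vdegree :: "'a ugraph \<Rightarrow> 'a \<Rightarrow> nat" where
  "vdegree G v = card (nbrs G v)"

definition cubic_graph :: "'a ugraph \<Rightarrow> bool" where
  "cubic_graph G \<longleftrightarrow> (\<forall>v\<in>uverts G. vdegree G v = 3)"

definition joined :: "'a ugraph \<Rightarrow> 'a \<Rightarrow> 'a \<Rightarrow> bool" where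
  "joined G u v \<longleftrightarrow> (u, v) \<in> {(x, y). {x, y} \<in> uedges G}\<^sup>*"

definition connected_graph :: "'a ugraph \<Rightarrow> bool" where
  "connected_graph G \<longleftrightarrow>
     uverts G \<noteq> {} \<and> (\<forall>u\<in>uverts G. \<forall>v\<in>uverts G. joined G u v)"

definition delete_edge :: "'a ugraph \<Rightarrow> 'a set \<Rightarrow> 'a ugraph" where
  "delete_edge G e = \<lparr>uverts = uverts G, uedges = uedges G - {e}\<rparr>"

definition add_edge :: "'a ugraph \<Rightarrow> 'a set \<Rightarrow> 'a ugraph" where
  "add_edge G e = \<lparr>uverts = uverts G, uedges = insert e (uedges G)\<rparr>"

text \<open>A bridge is an edge that separates its ends.\<close>

definition bridge :: "'a ugraph \<Rightarrow> 'a set \<Rightarrow> bool" where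
  "bridge G e \<longleftrightarrow>
     e \<in> uedges G \<and> (\<exists>u v. e = {u, v} \<and> \<not> joined (delete_edge G e) u v)"

definition bridgeless :: "'a ugraph \<Rightarrow> bool" where
  "bridgeless G \<longleftrightarrow> (\<nexists>e. bridge G e)"

definition graph_iso :: "'a ugraph \<Rightarrow> 'b ugraph \<Rightarrow> bool" where
  "graph_iso G H \<longleftrightarrow>
     (\<exists>f. bij_betw f (uverts G) (uverts H) \<and>
          (\<forall>u\<in>uverts G. \<forall>v\<in>uverts G. {u, v} \<in> uedges G \<longleftrightarrow> {f u, f v} \<in> uedges H))"

definition bipartition :: "'a ugraph \<Rightarrow> 'a set \<Rightarrow> 'a set \<Rightarrow> bool" where
  "bipartition G A B \<longleftrightarrow>
     A \<union> B = uverts G \<and> A \<inter> B = {} \<and>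
     (\<forall>e\<in>uedges G. \<exists>a\<in>A. \<exists>b\<in>B. e = {a, b})"

definition bipartite_graph :: "'a ugraph \<Rightarrow> bool" where
  "bipartite_graph G \<longleftrightarrow> simple_graph G \<and> (\<exists>A B. bipartition G A B)"

text \<open>The vertices \<open>a\<^sub>i\<close> and \<open>b\<^sub>i\<close> are encoded as \<open>i\<close> and \<open>4 + i\<close>. The type \<open>nat\<close> is used
  because augmentations need a supply of new vertices.\<close>

definition L8 :: "nat ugraph" where
  "L8 = \<lparr>uverts = {..<8},
         uedges = {{i, (i + 1) mod 4} |i. i < 4}
                \<union> {{4 + i, 4 + (i + 1) mod 4} |i. i < 4}
                \<union> {{i, 4 + i} |i. i < 4}\<rparr>"

text \<open>\<open>expansion H x N1 N2 x1 v x2\<close> is the graph obtained by expanding \<open>x\<close> to the path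
  \<open>x1 v x2\<close>, subject to the side conditions in \<open>expandable\<close>.\<close>

definition expandable :: "'a ugraph \<Rightarrow> 'a \<Rightarrow> 'a set \<Rightarrow> 'a set \<Rightarrow> 'a \<Rightarrow> 'a \<Rightarrow> 'a \<Rightarrow> bool" where
  "expandable H x N1 N2 x1 v x2 \<longleftrightarrow>
     x \<in> uverts H \<and> vdegree H x \<ge> 4 \<and>
     N1 \<union> N2 = nbrs H x \<and> N1 \<inter> N2 = {} \<and> card N1 \<ge> 2 \<and> card N2 \<ge> 2 \<and>
     distinct [x1, v, x2] \<and> {x1, v, x2} \<inter> uverts H = {}"

definition expansion :: "'a ugraph \<Rightarrow> 'a \<Rightarrow> 'a set \<Rightarrow> 'a set \<Rightarrow> 'a \<Rightarrow> 'a \<Rightarrow> 'a \<Rightarrow> 'a ugraph" where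
  "expansion H x N1 N2 x1 v x2 =
     \<lparr>uverts = (uverts H - {x}) \<union> {x1, v, x2},
      uedges = {e \<in> uedges H. x \<notin> e}
             \<union> {{x1, v}, {v, x2}}
             \<union> {{y, x1} |y. y \<in> N1}
             \<union> {{y, x2} |y. y \<in> N2}\<rparr>"

definition type1_augmentation :: "'a ugraph \<Rightarrow> 'a ugraph \<Rightarrow> bool" where
  "type1_augmentation H H' \<longleftrightarrow>
     bipartite_graph H \<and> bipartite_graph H' \<and>
     (\<exists>a\<in>uverts H. \<exists>b\<in>uverts H. a \<noteq> b \<and> {a, b} \<notin> uedges H \<and> H' = add_edge H {a, b})"

definition type2_augmentation :: "'a ugraph \<Rightarrow> 'a ugraph \<Rightarrow> bool" where
  "type2_augmentation H H' \<longleftrightarrow>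
     bipartite_graph H \<and>
     (\<exists>A B x w N1 N2 x1 v x2.
        bipartition H A B \<and> x \<in> A \<and> w \<in> A \<and> x \<noteq> w \<and>
        expandable H x N1 N2 x1 v x2 \<and>
        H' = add_edge (expansion H x N1 N2 x1 v x2) {v, w})"

definition simple_augmentation :: "'a ugraph \<Rightarrow> 'a ugraph \<Rightarrow> bool" where
  "simple_augmentation H H' \<longleftrightarrow> type1_augmentation H H' \<or> type2_augmentation H H'"

text \<open>\<open>idx v u\<close> is the index assigned at \<open>v\<close> to its neighbour \<open>u\<close>.\<close>

definition hexagon_indexing :: "'a ugraph \<Rightarrow> ('a \<Rightarrow> 'a \<Rightarrow> nat) \<Rightarrow> bool" where
  "hexagon_indexing G idx \<longleftrightarrow>
     (\<forall>v\<in>uverts G. idx v ` nbrs G v \<subseteq> {0, 1, 2} \<and> inj_on (idx v) (nbrs G v))"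

text \<open>The vertex \<open>v\<^sub>i\<close> of the hexagon at \<open>v\<close> is \<open>(v, i)\<close> with \<open>i < 6\<close>, the residues modulo 6
  being represented by \<open>0, \<dots>, 5\<close>; it lies in \<open>X\<close> if \<open>i\<close> is even and in \<open>Y\<close> if \<open>i\<close> is odd.\<close>

definition link_edges :: "('a \<Rightarrow> 'a \<Rightarrow> nat) \<Rightarrow> 'a \<Rightarrow> 'a \<Rightarrow> ('a \<times> nat) set set" where
  "link_edges idx u v =
     (let i = idx v u; j = idx u v in
      if even i \<longleftrightarrow> even j
      then {{(v, i), (u, (j + 3) mod 6)}, {(v, (i + 3) mod 6), (u, j)}}
      else {{(v, i), (u, j)}, {(v, (i + 3) mod 6), (u, (j + 3) mod 6)}})"

lemma link_edges_commute: "link_edges idx u v = link_edges idx v u"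
  by (auto simp: link_edges_def Let_def insert_commute)

definition hexagon_graph :: "'a ugraph \<Rightarrow> ('a \<Rightarrow> 'a \<Rightarrow> nat) \<Rightarrow> ('a \<times> nat) ugraph" where
  "hexagon_graph G idx =
     \<lparr>uverts = uverts G \<times> {..<6},
      uedges = {{(v, i), (v, (i + 1) mod 6)} |v i. v \<in> uverts G \<and> i < 6}
             \<union> {{(v, i), (v, (i + 3) mod 6)} |v i. v \<in> uverts G \<and> i < 6}
             \<union> \<Union> {link_edges idx u v |u v. {u, v} \<in> uedges G}\<rparr>"

end

theory Submission imports Defs begin

text \<open>Name the vertices of the hexagon graph by darts \<open>(v, u)\<close> (an edge \<open>v u\<close> seen from \<open>v\<close>), once
  in \<open>X\<close> and once in \<open>Y\<close>. Then an \<open>X\<close>-dart and a \<open>Y\<close>-dart are adjacent iff they sit at the same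
  vertex or are reverse to each other: the hexagon graph is the bipartite double cover of the
  truncation of \<open>G\<close> (every vertex blown up to a triangle) with a loop added at every vertex. In
  the same sense \<open>L8\<close> is the double cover of the 4-cycle.

  On the level of the underlying graph, three type-2 and two type-1 augmentations replace an
  edge by a triangle subdividing it, and two type-1 augmentations add an edge. So the truncation
  of \<open>G\<close> is built along an ear decomposition of \<open>G\<close>: the ends of an ear are first joined by a
  single edge, which is then subdivided by one triangle for every inner vertex of the ear. The
  start is a cycle of \<open>G\<close>, seen as an ear whose ends are adjacent vertices: two triangles
  joined by two edges, one of which stands for the rest of the cycle.\<close>

section \<open>Bipartite graphs as relations\<close>

text \<open>The last premise of \<open>step\<close> is needed because
  \<open>type2_augmentation\<close> does not state that its result is bipartite, while every member
  of the final sequence has to be.\<close>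

inductive reachable :: "nat ugraph \<Rightarrow> bool" where
  start: "reachable L8"
| step: "reachable H \<Longrightarrow> simple_augmentation H H' \<Longrightarrow> bipartite_graph H' \<Longrightarrow> reachable H'"

text \<open>The two classes of \<open>H\<close> are labelled by \<open>L\<close> and \<open>R\<close>; the labels may overlap, and below both
  sets mostly consist of the same darts.\<close>

definition bip_rep :: "'l set \<Rightarrow> 'r set \<Rightarrow> ('l \<times> 'r) set \<Rightarrow> ('l \<Rightarrow> 'a) \<Rightarrow> ('r \<Rightarrow> 'a) \<Rightarrow> 'a ugraph \<Rightarrow> bool" where
  "bip_rep L R E f g H \<longleftrightarrow>
     inj_on f L \<and> inj_on g R \<and> f ` L \<inter> g ` R = {} \<and> E \<subseteq> L \<times> R \<and>
     uverts H = f ` L \<union> g ` R \<and> uedges H = (\<lambda>(a, b). {f a, g b}) ` E"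

text \<open>Hiding \<open>H\<close>, \<open>f\<close> and \<open>g\<close> turns augmentations into
  operations on relations, free of the choice of names for new vertices.\<close>

definition generated :: "'l set \<Rightarrow> 'r set \<Rightarrow> ('l \<times> 'r) set \<Rightarrow> bool" where
  "generated L R E \<longleftrightarrow> (\<exists>H f g. reachable H \<and> bip_rep L R E f g H)"

lemma bip_rep_bipartition:
  assumes "bip_rep L R E f g H"
  shows "bipartition H (f ` L) (g ` R)"
  using assms unfolding bip_rep_def bipartition_def by fastforce

lemma bip_rep_bipartite:
  assumes "bip_rep L R E f g H" "finite L" "finite R"
  shows "bipartite_graph H"
proof -
  have "card {f a, g b} = 2" if "(a, b) \<in> E" for a b
  proof -
    have "f a \<noteq> g b" using that assms(1) unfolding bip_rep_def by blast
    then show ?thesis by simp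
  qed
  then have "simple_graph H"
    using assms unfolding simple_graph_def bip_rep_def by auto
  then show ?thesis
    using bip_rep_bipartition[OF assms(1)] unfolding bipartite_graph_def by blast
qed

lemma bip_rep_edge_iff:
  assumes "bip_rep L R E f g H" "a \<in> L" "b \<in> R"
  shows "{f a, g b} \<in> uedges H \<longleftrightarrow> (a, b) \<in> E"
proof
  assume "{f a, g b} \<in> uedges H"
  then obtain a' b' where ab: "(a', b') \<in> E" "{f a, g b} = {f a', g b'}"
    using assms(1) unfolding bip_rep_def by auto
  have "a' \<in> L" "b' \<in> R" using ab(1) assms(1) unfolding bip_rep_def by auto
  moreover have "f a \<noteq> g b'" "f a' \<noteq> g b"
    using assms calculation unfolding bip_rep_def by blast+
  then have "f a = f a'" "g b = g b'" using ab(2) by (auto simp: doubleton_eq_iff)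
  ultimately have "a = a'" "b = b'"
    using assms unfolding bip_rep_def by (auto dest: inj_onD)
  then show "(a, b) \<in> E" using ab by simp
next
  assume "(a, b) \<in> E"
  then show "{f a, g b} \<in> uedges H" using assms(1) unfolding bip_rep_def by force
qed

lemma bip_rep_swap: "bip_rep L R E f g H \<Longrightarrow> bip_rep R L (E\<inverse>) g f H"
  unfolding bip_rep_def by (auto simp: insert_commute image_iff)

text \<open>Serves to compare the graph reached at the end with the hexagon graph: both represent
  the same relation on darts.\<close>

lemma bip_rep_iso:
  assumes X: "bip_rep L R E f g X" and Y: "bip_rep L R E h k Y"
  shows "graph_iso X Y"
proof -
  define \<phi> where "\<phi> z = (if z \<in> f ` L then h (inv_into L f z) else k (inv_into R g z))" for z
  have inj: "inj_on f L" "inj_on g R" "inj_on h L" "inj_on k R"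
    and disj: "f ` L \<inter> g ` R = {}" "h ` L \<inter> k ` R = {}"
    and V: "uverts X = f ` L \<union> g ` R" "uverts Y = h ` L \<union> k ` R"
    using X Y unfolding bip_rep_def by auto
  have \<phi>f: "\<phi> (f a) = h a" if "a \<in> L" for a using that inj by (simp add: \<phi>_def)
  have \<phi>g: "\<phi> (g b) = k b" if "b \<in> R" for b
  proof -
    have "g b \<notin> f ` L" using that disj by blast
    then show ?thesis using that inj by (simp add: \<phi>_def)
  qed
  have "inj_on \<phi> (uverts X)"
  proof (rule inj_onI)
    fix x y assume xy: "x \<in> uverts X" "y \<in> uverts X" "\<phi> x = \<phi> y"
    have "h a \<noteq> k b" if "a \<in> L" "b \<in> R" for a b using that disj by blast
    then show "x = y" using xy inj unfolding V
      by (auto simp: \<phi>f \<phi>g dest: inj_onD) (metis \<phi>f \<phi>g)+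
  qed
  moreover have "\<phi> ` uverts X = uverts Y"
    unfolding V using \<phi>f \<phi>g by (force simp: image_Un image_image)
  ultimately have "bij_betw \<phi> (uverts X) (uverts Y)" by (simp add: bij_betw_def)
  moreover have "{x, y} \<in> uedges X \<longleftrightarrow> {\<phi> x, \<phi> y} \<in> uedges Y"
    if xy: "x \<in> uverts X" "y \<in> uverts X" for x y
  proof -
    \<comment> \<open>Pairs inside one class are never edges, since the classes are disjoint; this
      settles the last two cases below.\<close>
    have no: "{c, d} \<notin> uedges Z"
      if rep: "bip_rep L R E f' g' Z" and sub: "{c, d} \<subseteq> f' ` L \<or> {c, d} \<subseteq> g' ` R"
      for c d f' g' and Z :: "'z ugraph"
    proof
      assume "{c, d} \<in> uedges Z"
      then obtain a b where "{c, d} = {f' a, g' b}" "a \<in> L" "b \<in> R"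
        using rep unfolding bip_rep_def by auto
      then show False using rep sub unfolding bip_rep_def by (auto simp: doubleton_eq_iff)
    qed
    consider a b where "a \<in> L" "b \<in> R" "x = f a" "y = g b"
      | a b where "a \<in> L" "b \<in> R" "y = f a" "x = g b"
      | a a' where "a \<in> L" "a' \<in> L" "x = f a" "y = f a'"
      | b b' where "b \<in> R" "b' \<in> R" "x = g b" "y = g b'"
      using xy unfolding V by blast
    then show ?thesis
    proof cases
      case 1
      then show ?thesis using bip_rep_edge_iff[OF X] bip_rep_edge_iff[OF Y] by (simp add: \<phi>f \<phi>g)
    next
      case 2
      then show ?thesis using bip_rep_edge_iff[OF X] bip_rep_edge_iff[OF Y]
        by (simp add: \<phi>f \<phi>g insert_commute)
    next
      case 3
      then show ?thesis using no[OF X, of x y] no[OF Y, of "\<phi> x" "\<phi> y"] by (simp add: \<phi>f)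
    next
      case 4
      then show ?thesis using no[OF X, of x y] no[OF Y, of "\<phi> x" "\<phi> y"] by (simp add: \<phi>g)
    qed
  qed
  ultimately show ?thesis unfolding graph_iso_def by blast
qed

text \<open>The cube is K4,4 minus a perfect matching, the four removed pairs being the antipodal
  ones.\<close>

lemma bip_rep_L8:
  "bip_rep {0, 2, 5, 7} {1, 3, 4, 6}
     ({0, 2, 5, 7} \<times> {1, 3, 4, 6} - {(0, 6), (2, 4), (5, 3), (7, 1)}) (\<lambda>x. x) (\<lambda>x. x) L8"
proof -
  have V: "uverts L8 = {0, 2, 5, 7} \<union> {1, 3, 4, 6}" by (auto simp: L8_def)
  have E: "{0, 2, 5, 7} \<times> {1, 3, 4, 6} - {(0, 6), (2, 4), (5, 3), (7, 1)} =
    {(0::nat, 1::nat), (0, 3), (0, 4), (2, 1), (2, 3), (2, 6), (5, 1), (5, 4), (5, 6),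
     (7, 3), (7, 4), (7, 6)}" by auto
  have four: "{f i |i. i < (4::nat)} = {f 0, f 1, f 2, f 3}" for f :: "nat \<Rightarrow> nat set"
  proof -
    have "{f i |i. i < 4} = f ` {..<4}" by auto
    also have "{..<4::nat} = {0, 1, 2, 3}" by auto
    finally show ?thesis by (simp only: image_insert image_empty)
  qed
  have "uedges L8 = {{0, 4}, {1, 5}, {2, 6}, {3, 7}, {4, 5}, {5, 6}, {6, 7}, {7, 4},
      {0, 1}, {1, 2}, {2, 3}, {3, 0}}"
    unfolding L8_def ugraph.simps four by (simp flip: numeral_2_eq_2)
  also have "\<dots> = (\<lambda>(a, b). {a, b}) `
    {(0, 1), (0, 3), (0, 4), (2, 1), (2, 3), (2, 6), (5, 1), (5, 4), (5, 6),
     (7, 3), (7, 4), (7, 6)}"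
    unfolding image_insert image_empty prod.case
    by (intro equalityI; simp only: insert_subset empty_subsetI) (simp_all add: doubleton_eq_iff)
  finally show ?thesis unfolding bip_rep_def E V by simp
qed

lemma reachable_sequence:
  assumes "reachable X"
  shows "\<exists>(k::nat) H. H 0 = L8 \<and> H k = X \<and>
           (\<forall>i\<in>{0..k}. bipartite_graph (H i)) \<and>
           (\<forall>i\<in>{1..k}. simple_augmentation (H (i - 1)) (H i))"
  using assms
proof induction
  case start
  have "bip_rep {0, 2, 5, 7} {1, 3, 4, 6}
     ({0, 2, 5, 7} \<times> {1, 3, 4, 6} - {(0, 6), (2, 4), (5, 3), (7, 1)}) (\<lambda>x. x) (\<lambda>x. x) L8"
    using bip_rep_L8 .
  then have "bipartite_graph L8" by (rule bip_rep_bipartite) auto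
  then show ?case by (intro exI[of _ 0] exI[of _ "\<lambda>_. L8"]) auto
next
  case (step X X')
  then obtain k :: nat and H where "H 0 = L8" "H k = X" "\<forall>i\<in>{0..k}. bipartite_graph (H i)"
     "\<forall>i\<in>{1..k}. simple_augmentation (H (i - 1)) (H i)" by blast
  then show ?case using step.hyps
    by (intro exI[of _ "Suc k"] exI[of _ "H(Suc k := X')"]) (auto simp: le_Suc_eq)
qed

section \<open>Type-1 and type-2 augmentations in terms of labels\<close>

lemma generated_finite:
  assumes "generated L R E"
  shows "finite L" "finite R"
proof -
  obtain H f g where H: "reachable H" "bip_rep L R E f g H"
    using assms unfolding generated_def by blast
  have "bipartite_graph H" using reachable_sequence[OF H(1)] by fastforce
  then have "finite (f ` L \<union> g ` R)"
    using H(2) unfolding bipartite_graph_def simple_graph_def bip_rep_def by simp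
  then show "finite L" "finite R"
    using H(2) unfolding bip_rep_def by (auto dest: finite_imageD)
qed

text \<open>Exchanging the classes lets \<open>generated_split\<close>, which expands right vertices
  only, act on left vertices too.\<close>

lemma generated_swap: "generated L R E \<Longrightarrow> generated R L (E\<inverse>)"
  unfolding generated_def using bip_rep_swap by blast

text \<open>An edge that is already present costs no augmentation, so callers need not check that it
  is new.\<close>

lemma generated_add:
  assumes gen: "generated L R E" and ab: "a \<in> L" "b \<in> R"
  shows "generated L R (insert (a, b) E)"
proof (cases "(a, b) \<in> E")
  case True
  then show ?thesis using gen by (simp add: insert_absorb)
next
  case False
  obtain H f g where H: "reachable H" "bip_rep L R E f g H"
    using gen unfolding generated_def by blast
  let ?H = "add_edge H {f a, g b}"
  have rep: "bip_rep L R (insert (a, b) E) f g ?H"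
    using H(2) ab unfolding bip_rep_def by (auto simp: add_edge_def)
  note fin = generated_finite[OF gen]
  have "f a \<noteq> g b" using H(2) ab unfolding bip_rep_def by blast
  moreover have "f a \<in> uverts H" "g b \<in> uverts H" using H(2) ab unfolding bip_rep_def by auto
  ultimately have "simple_augmentation H ?H"
    using False bip_rep_bipartite[OF H(2) fin] bip_rep_bipartite[OF rep fin]
      bip_rep_edge_iff[OF H(2) ab]
    unfolding simple_augmentation_def type1_augmentation_def by blast
  then have "reachable ?H" using H(1) bip_rep_bipartite[OF rep fin] by (blast intro: step)
  then show ?thesis using rep unfolding generated_def by blast
qed

lemma Collect_mem_image_eq: "{y \<in> h ` A. P y} = h ` {x \<in> A. P (h x)}"
  by blast

text \<open>The label \<open>x\<close> is reused for the new vertex that inherits \<open>N1\<close>, so that only one right label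
  is new.\<close>

lemma generated_split:
  assumes gen: "generated L R E"
    and x: "x \<in> R" and w: "w \<in> R" "w \<noteq> x" and v: "v \<notin> L" and y: "y \<notin> R"
    and N: "N1 \<union> N2 = {n. (n, x) \<in> E}" "N1 \<inter> N2 = {}" "card N1 \<ge> 2" "card N2 \<ge> 2"
  shows "generated (insert v L) (insert y R)
           ({e \<in> E. snd e \<noteq> x} \<union> N1 \<times> {x} \<union> N2 \<times> {y} \<union> {(v, x), (v, y), (v, w)})"
    (is "generated ?L ?R ?E")
proof -
  obtain H f g where H: "reachable H" "bip_rep L R E f g H"
    using gen unfolding generated_def by blast
  note fin = generated_finite[OF gen]
  have inj: "inj_on f L" "inj_on g R" and disj: "f ` L \<inter> g ` R = {}"
    and V: "uverts H = f ` L \<union> g ` R" and EH: "uedges H = (\<lambda>(a, b). {f a, g b}) ` E"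
    and EL: "E \<subseteq> L \<times> R"
    using H(2) unfolding bip_rep_def by auto
  have NL: "N1 \<subseteq> L" "N2 \<subseteq> L" using N(1) EL by auto
  have finV: "finite (uverts H)" using fin V by simp
  obtain x1 where x1: "x1 \<notin> uverts H" using finV by (metis ex_new_if_finite infinite_UNIV_nat)
  obtain v0 where v0: "v0 \<notin> insert x1 (uverts H)"
    using finV by (metis ex_new_if_finite finite_insert infinite_UNIV_nat)
  obtain x2 where x2: "x2 \<notin> insert v0 (insert x1 (uverts H))"
    using finV by (metis ex_new_if_finite finite_insert infinite_UNIV_nat)
  define f' where "f' = f(v := v0)"
  define g' where "g' = g(x := x1, y := x2)"
  let ?X = "expansion H (g x) (f ` N1) (f ` N2) x1 v0 x2"
  let ?H = "add_edge ?X {v0, g w}"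
  have xy: "x \<noteq> y" using x y by blast
  have f'L: "f' a = f a" if "a \<in> L" for a using that v by (auto simp: f'_def)
  have g'R: "g' b = g b" if "b \<in> R" "b \<noteq> x" for b using that y by (auto simp: g'_def)
  have new: "f' v = v0" "g' x = x1" "g' y = x2" using xy by (auto simp: f'_def g'_def)
  have gx: "g b \<noteq> g x" if "b \<in> R" "b \<noteq> x" for b using that x inj by (auto dest: inj_onD)
  have fg: "f a \<noteq> g b" if "a \<in> L" "b \<in> R" for a b using that disj by blast
  have nb: "nbrs H (g x) = f ` {n. (n, x) \<in> E}"
  proof -
    have "u \<in> f ` {n. (n, x) \<in> E}" if u: "{g x, u} \<in> uedges H" for u
    proof -
      obtain a b where ab: "(a, b) \<in> E" "{g x, u} = {f a, g b}" using u EH by auto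
      then have "a \<in> L" "b \<in> R" using EL by auto
      then have "g x = g b" "u = f a" using ab(2) fg[OF _ x, of a] by (auto simp: doubleton_eq_iff)
      then have "b = x" using \<open>b \<in> R\<close> gx by metis
      then show ?thesis using ab \<open>u = f a\<close> by blast
    qed
    moreover have "{g x, f n} \<in> uedges H" if "(n, x) \<in> E" for n
      using that EH by (force simp: insert_commute)
    ultimately show ?thesis unfolding nbrs_def by blast
  qed
  have cards: "card (f ` N1) \<ge> 2" "card (f ` N2) \<ge> 2"
    using N NL inj by (auto simp: card_image inj_on_subset)
  have disjN: "f ` N1 \<inter> f ` N2 = {}" using N(2) NL inj by (metis image_empty inj_on_image_Int)
  \<comment> \<open>Two disjoint parts of size at least 2 already force the degree that an expansion
    requires.\<close>
  have "vdegree H (g x) = card (f ` N1 \<union> f ` N2)"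
    unfolding vdegree_def nb N(1)[symmetric] by (simp add: image_Un)
  also have "\<dots> = card (f ` N1) + card (f ` N2)"
    using NL fin disjN by (intro card_Un_disjoint) (auto intro: finite_subset)
  finally have "vdegree H (g x) \<ge> 4" using cards by simp
  then have "expandable H (g x) (f ` N1) (f ` N2) x1 v0 x2"
    using cards disjN nb N(1) x x1 v0 x2 unfolding expandable_def V by (auto simp: image_Un)
  \<comment> \<open>\<open>type2_augmentation\<close> takes \<open>x\<close> and \<open>w\<close>
    from the first class, so the right side comes first here.\<close>
  moreover have bip: "bipartition H (g ` R) (f ` L)"
    using bip_rep_bipartition[OF bip_rep_swap[OF H(2)]] .
  moreover have "g x \<in> g ` R" "g w \<in> g ` R" "g x \<noteq> g w" using x w gx[OF w] by auto
  ultimately have "type2_augmentation H ?H"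
    using bip_rep_bipartite[OF H(2) fin] unfolding type2_augmentation_def by blast
  then have aug: "simple_augmentation H ?H" unfolding simple_augmentation_def ..
  have old: "{e \<in> uedges H. g x \<notin> e} = (\<lambda>(a, b). {f' a, g' b}) ` {e \<in> E. snd e \<noteq> x}"
  proof -
    have "{e \<in> uedges H. g x \<notin> e} = (\<lambda>(a, b). {f a, g b}) ` {e \<in> E. snd e \<noteq> x}"
    proof -
      have "g x \<in> {f a, g b} \<longleftrightarrow> b = x" if "(a, b) \<in> E" for a b
      proof -
        have "a \<in> L" "b \<in> R" using that EL by auto
        then show ?thesis using fg[of a x] gx[of b] x by (cases "b = x") auto
      qed
      then have "{e \<in> E. g x \<notin> (case e of (a, b) \<Rightarrow> {f a, g b})} = {e \<in> E. snd e \<noteq> x}"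
        by (simp cong: conj_cong add: case_prod_unfold)
      then show ?thesis unfolding EH Collect_mem_image_eq by simp
    qed
    also have "\<dots> = (\<lambda>(a, b). {f' a, g' b}) ` {e \<in> E. snd e \<noteq> x}"
      using EL by (intro image_cong) (auto simp: f'L g'R)
    finally show ?thesis .
  qed
  have img: "(\<lambda>(a, b). {f' a, g' b}) ` (N \<times> {z}) = {{u, g' z} |u. u \<in> f ` N}"
    if "N \<subseteq> L" for N z
  proof -
    have "(\<lambda>(a, b). {f' a, g' b}) ` (N \<times> {z}) = (\<lambda>a. {f' a, g' z}) ` N" by auto
    also have "\<dots> = (\<lambda>a. {f a, g' z}) ` N"
      using that by (intro image_cong) (auto simp: f'L)
    finally show ?thesis by (simp only: image_image Setcompr_eq_image)
  qed
  have old_f: "f' a \<in> f ` L" if "a \<in> L" for a using that f'L by simp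
  have old_g: "g' b \<in> g ` R" if "b \<in> R" "b \<noteq> x" for b using that g'R by simp
  have "uedges ?H = (\<lambda>(a, b). {f' a, g' b}) ` ?E"
    unfolding image_Un img[OF NL(1)] img[OF NL(2)] old[symmetric] image_insert prod.case new g'R[OF w]
    unfolding add_edge_def expansion_def by (simp add: insert_commute Un_ac)
  moreover have "uverts ?H = f' ` ?L \<union> g' ` ?R"
  proof -
    have "f' ` ?L = insert v0 (f ` L)" using f'L new by auto
    moreover have "g' ` R = insert x1 (g' ` (R - {x}))"
      using new(2) x by (metis image_insert insert_Diff)
    moreover have "g' ` (R - {x}) = g ` (R - {x})" using g'R by (intro image_cong) auto
    moreover have "g ` (R - {x}) = g ` R - {g x}"
      using inj_on_image_set_diff[OF inj(2), of R "{x}"] x by simp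
    moreover have "g x \<notin> f ` L" using disj x by blast
    ultimately show ?thesis
      unfolding image_insert new by (auto simp: add_edge_def expansion_def V)
  qed
  moreover have "inj_on f' ?L"
  proof -
    have "inj_on f' L" using inj(1) f'L by (simp cong: inj_on_cong)
    moreover have "f' v \<notin> f' ` L" using old_f v0 unfolding new V by auto
    ultimately show ?thesis using v by (simp add: inj_on_insert)
  qed
  moreover have "inj_on g' ?R"
  proof -
    have "inj_on g' (R - {x})"
      using inj(2) g'R by (auto simp: inj_on_def)
    moreover have "g' x \<notin> g' ` (R - {x})" using old_g x1 unfolding new V by auto
    ultimately have "inj_on g' (insert x (R - {x}))" unfolding inj_on_insert by simp
    then have "inj_on g' R" using insert_Diff[OF x] by metis
    moreover have "g' y \<notin> g' ` R"
    proof
      assume "g' y \<in> g' ` R"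
      then obtain b where "b \<in> R" "g' b = x2" using new by auto
      then show False using old_g[of b] x2 new V by (cases "b = x") auto
    qed
    ultimately show ?thesis using y by (simp add: inj_on_insert)
  qed
  moreover have "f' ` ?L \<inter> g' ` ?R = {}"
  proof -
    have "f' a \<noteq> g' b" if "a \<in> ?L" "b \<in> ?R" for a b
    proof -
      have "f' a = v0 \<or> f' a \<in> f ` L" using that old_f new by auto
      moreover have "g' b = x1 \<or> g' b = x2 \<or> g' b \<in> g ` R" using that old_g new by (cases "b = x") auto
      ultimately show ?thesis using x1 x2 v0 disj unfolding V
        by (metis UnCI disjoint_iff insertCI)
    qed
    then show ?thesis by blast
  qed
  moreover have "?E \<subseteq> ?L \<times> ?R" using EL NL x w by auto
  ultimately have rep: "bip_rep ?L ?R ?E f' g' ?H"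
    unfolding bip_rep_def by (intro conjI)
  have "bipartite_graph ?H" using bip_rep_bipartite[OF rep] fin by simp
  then have "reachable ?H" using H(1) aug by (blast intro: step)
  then show ?thesis using rep unfolding generated_def by blast
qed

lemma generated_L8:
  assumes L: "distinct [a0, a1, a2, a3]" and R: "distinct [b0, b1, b2, b3]"
  shows "generated {a0, a1, a2, a3} {b0, b1, b2, b3}
           ({a0, a1, a2, a3} \<times> {b0, b1, b2, b3} - {(a0, b0), (a1, b1), (a2, b2), (a3, b3)})"
proof -
  \<comment> \<open>Labels of equal index go to antipodal vertices of the cube: 0 and 6, 2 and 4, 5
    and 3, 7 and 1.\<close>
  define f where "f x = (if x = a0 then 0 else if x = a1 then 2 else if x = a2 then 5 else 7 :: nat)" for x
  define g where "g x = (if x = b0 then 6 else if x = b1 then 4 else if x = b2 then 3 else 1 :: nat)" for x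
  have f: "f a0 = 0" "f a1 = 2" "f a2 = 5" "f a3 = 7" using L by (auto simp: f_def)
  have g: "g b0 = 6" "g b1 = 4" "g b2 = 3" "g b3 = 1" using R by (auto simp: g_def)
  have U: "uverts L8 = {0, 2, 5, 7} \<union> {1, 3, 4, 6}"
    and Ed: "uedges L8 = (\<lambda>(a, b). {a, b}) `
      ({0, 2, 5, 7} \<times> {1, 3, 4, 6} - {(0, 6), (2, 4), (5, 3), (7, 1)})"
    using bip_rep_L8 unfolding bip_rep_def by auto
  have Ex: "{a0, a1, a2, a3} \<times> {b0, b1, b2, b3} - {(a0, b0), (a1, b1), (a2, b2), (a3, b3)} =
    {(a0, b1), (a0, b2), (a0, b3), (a1, b0), (a1, b2), (a1, b3), (a2, b0), (a2, b1), (a2, b3),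
     (a3, b0), (a3, b1), (a3, b2)}" using L R by auto
  have Ex': "{0, 2, 5, 7} \<times> {1, 3, 4, 6} - {(0, 6), (2, 4), (5, 3), (7, 1)} =
    {(0::nat, 4::nat), (0, 3), (0, 1), (2, 6), (2, 3), (2, 1), (5, 6), (5, 4), (5, 1),
     (7, 6), (7, 4), (7, 3)}" by auto
  have "inj_on f {a0, a1, a2, a3}" "inj_on g {b0, b1, b2, b3}"
    unfolding inj_on_def by (simp_all add: f g)
  then have "bip_rep {a0, a1, a2, a3} {b0, b1, b2, b3}
     ({a0, a1, a2, a3} \<times> {b0, b1, b2, b3} - {(a0, b0), (a1, b1), (a2, b2), (a3, b3)}) f g L8"
    unfolding bip_rep_def U Ed Ex Ex' by (simp del: inj_on_insert add: f g insert_commute)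
  then show ?thesis unfolding generated_def using start by blast
qed

section \<open>Augmentations of double covers\<close>

lemma generated_add_subset:
  assumes "generated L R E" "finite D" "D \<subseteq> L \<times> R"
  shows "generated L R (E \<union> D)"
  using assms(2,3)
proof induction
  case empty
  then show ?case using assms(1) by simp
next
  case (insert d D)
  then show ?case using generated_add[of L R "E \<union> D" "fst d" "snd d"] by auto
qed

text \<open>For explicit finite \<open>S\<close> and \<open>T\<close> this reduces an equality of
  relations to finitely many pairs that simplification can decide.\<close>

lemma rel_eqI:
  assumes "A \<subseteq> S \<times> T" "B \<subseteq> S \<times> T" "\<forall>m\<in>S. \<forall>n\<in>T. (m, n) \<in> A \<longleftrightarrow> (m, n) \<in> B"
  shows "A = B"
  using assms by blast

text \<open>Eight of the twelve vertices come from \<open>L8\<close>, where the right copies of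
  \<open>p1\<close> and \<open>q1\<close> also play the parts of the right copies of
  \<open>q0\<close> and \<open>p0\<close>. Two splittings separate them and create the left copies
  of \<open>q1\<close> and \<open>p1\<close>; the edges still missing are then added.\<close>

lemma generated_two_triangles:
  assumes d: "distinct [p0, p1, p2, q0, q1, q2]"
  shows "generated {p0, p1, p2, q0, q1, q2} {p0, p1, p2, q0, q1, q2}
     ({p0, p1, p2} \<times> {p0, p1, p2} \<union> {q0, q1, q2} \<times> {q0, q1, q2} \<union>
      {(p1, q1), (q1, p1), (p2, q2), (q2, p2)})"
proof -
  let ?E0 = "{p0, p2, q0, q2} \<times> {p1, p2, q1, q2} - {(p0, q2), (p2, p1), (q0, p2), (q2, q1)}"
  \<comment> \<open>This edge raises the degree of the right \<open>p1\<close> from 3 to 4, so that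
    it can be expanded.\<close>
  let ?E1 = "insert (p2, p1) ?E0"
  let ?E2 = "{e \<in> ?E1. snd e \<noteq> p1} \<union> {p0, p2} \<times> {p1} \<union> {q0, q2} \<times> {q0} \<union>
    {(q1, p1), (q1, q0), (q1, q1)}"
  \<comment> \<open>The right \<open>q1\<close> has three neighbours in \<open>?E1\<close>; the edge
    \<open>(q1, q1)\<close> created by the first splitting is the fourth.\<close>
  let ?E3 = "{e \<in> ?E2. snd e \<noteq> q1} \<union> {q0, q1} \<times> {q1} \<union> {p0, p2} \<times> {p0} \<union>
    {(p1, q1), (p1, p0), (p1, p1)}"
  have "generated {p0, p2, q0, q2} {q2, p1, p2, q1}
     ({p0, p2, q0, q2} \<times> {q2, p1, p2, q1} - {(p0, q2), (p2, p1), (q0, p2), (q2, q1)})"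
    using d by (intro generated_L8) auto
  moreover have "{q2, p1, p2, q1} = {p1, p2, q1, q2}" by blast
  ultimately have "generated {p0, p2, q0, q2} {p1, p2, q1, q2} ?E0" by simp
  then have g1: "generated {p0, p2, q0, q2} {p1, p2, q1, q2} ?E1"
    by (intro generated_add) auto
  have g2: "generated (insert q1 {p0, p2, q0, q2}) (insert q0 {p1, p2, q1, q2}) ?E2"
    by (rule generated_split[OF g1]; use d in auto)
  have "generated (insert p1 (insert q1 {p0, p2, q0, q2}))
     (insert p0 (insert q0 {p1, p2, q1, q2})) ?E3"
    by (rule generated_split[OF g2]; use d in auto)
  moreover have "insert p1 (insert q1 {p0, p2, q0, q2}) = {p0, p1, p2, q0, q1, q2}"
    "insert p0 (insert q0 {p1, p2, q1, q2}) = {p0, p1, p2, q0, q1, q2}" by blast+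
  ultimately have g3: "generated {p0, p1, p2, q0, q1, q2} {p0, p1, p2, q0, q1, q2} ?E3" by simp
  have "generated {p0, p1, p2, q0, q1, q2} {p0, p1, p2, q0, q1, q2}
     (?E3 \<union> {(q2, q1), (q1, q2), (p1, p2)})"
    by (rule generated_add_subset[OF g3]) auto
  moreover have "?E3 \<union> {(q2, q1), (q1, q2), (p1, p2)} =
      {p0, p1, p2} \<times> {p0, p1, p2} \<union> {q0, q1, q2} \<times> {q0, q1, q2} \<union>
      {(p1, q1), (q1, p1), (p2, q2), (q2, p2)}" (is "?A = ?B")
  proof -
    let ?S = "{p0, p1, p2, q0, q1, q2}"
    have sub: "?A \<subseteq> ?S \<times> ?S" "?B \<subseteq> ?S \<times> ?S" by auto
    have "\<forall>m\<in>?S. \<forall>n\<in>?S. (m, n) \<in> ?A \<longleftrightarrow> (m, n) \<in> ?B"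
    proof -
      have "p0 \<noteq> p1" "p0 \<noteq> p2" "p0 \<noteq> q0" "p0 \<noteq> q1" "p0 \<noteq> q2" "p1 \<noteq> p2" "p1 \<noteq> q0"
        "p1 \<noteq> q1" "p1 \<noteq> q2" "p2 \<noteq> q0" "p2 \<noteq> q1" "p2 \<noteq> q2" "q0 \<noteq> q1" "q0 \<noteq> q2" "q1 \<noteq> q2"
        using d by simp_all
      then show ?thesis by simp
    qed
    then show ?thesis by (rule rel_eqI[OF sub])
  qed
  ultimately show ?thesis by simp
qed

text \<open>The underlying edge \<open>a b\<close> becomes the path \<open>a t1 t2 b\<close>. The three splittings create the left
  copies of \<open>t2\<close>, \<open>t3\<close>, \<open>t1\<close> and the right copies of \<open>t1\<close>, \<open>t2\<close>, \<open>t3\<close>, in this order;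
  afterwards only the edges at \<open>(t1, t1)\<close> and \<open>(b, b)\<close> are missing.\<close>

lemma generated_insert_triangle:
  assumes gen: "generated A A E"
    and ab: "a \<noteq> b" "(a, a) \<in> E" "(b, b) \<in> E" "(a, b) \<in> E" "(b, a) \<in> E"
    and Cl: "card {n. (n, b) \<in> E \<and> n \<noteq> a \<and> n \<noteq> b} \<ge> 2"
    and Cr: "card {n. (b, n) \<in> E \<and> n \<noteq> a \<and> n \<noteq> b} \<ge> 2"
    and D: "(c, a) \<in> E" "c \<noteq> a" "c \<noteq> b"
    and t: "distinct [t1, t2, t3]" "{t1, t2, t3} \<inter> A = {}"
  shows "generated (A \<union> {t1, t2, t3}) (A \<union> {t1, t2, t3})
    (E - {(a, b), (b, a)} \<union> {t1, t2, t3} \<times> {t1, t2, t3} \<union> {(a, t1), (t1, a), (t2, b), (b, t2)})"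
proof -
  have EA: "E \<subseteq> A \<times> A" using gen unfolding generated_def bip_rep_def by blast
  have A: "a \<in> A" "b \<in> A" "c \<in> A" using ab D EA by auto
  have tA: "t1 \<notin> A" "t2 \<notin> A" "t3 \<notin> A" using t by auto
  have ne: "a \<noteq> t1" "a \<noteq> t2" "a \<noteq> t3" "b \<noteq> t1" "b \<noteq> t2" "b \<noteq> t3" "t1 \<noteq> t2" "t1 \<noteq> t3" "t2 \<noteq> t3"
    using A tA t by auto
  have tE: "(t, n) \<notin> E" "(n, t) \<notin> E" if "t \<in> {t1, t2, t3}" for t n using that tA EA by auto
  have fin: "finite A" using generated_finite[OF gen] by simp
  define Nl where "Nl = {n. (n, b) \<in> E \<and> n \<noteq> a \<and> n \<noteq> b}"
  define Nr where "Nr = {n. (b, n) \<in> E \<and> n \<noteq> a \<and> n \<noteq> b}"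
  \<comment> \<open>\<open>b\<close> is left out because the second splitting moves the edge
    \<open>(b, a)\<close> to \<open>(t3, a)\<close>.\<close>
  define Na where "Na = {n. (n, a) \<in> E \<and> n \<noteq> b}"
  have N: "a \<notin> Nl" "b \<notin> Nl" "a \<notin> Nr" "b \<notin> Nr" "b \<notin> Na" "Nl \<subseteq> A" "Nr \<subseteq> A" "Na \<subseteq> A"
    using EA unfolding Nl_def Nr_def Na_def by auto
  \<comment> \<open>The neighbour \<open>c\<close> is assumed just for this: with \<open>a\<close>
    it makes \<open>Na\<close> large enough for the third splitting.\<close>
  have "card {a, c} \<le> card Na"
    using ab D N(8) fin by (intro card_mono) (auto simp: Na_def intro: finite_subset)
  then have cNa: "card Na \<ge> 2" using D by simp
  \<comment> \<open>The edges \<open>(b, t1)\<close> and \<open>(t2, a)\<close> are temporary: the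
    second splitting turns the former into \<open>(t3, t1)\<close>, the third turns the latter into
    \<open>(t2, t3)\<close>. The edge \<open>(b, b)\<close> is lost here and restored at the
    end.\<close>
  define E1 where "E1 = {e \<in> E. snd e \<noteq> b} \<union> Nl \<times> {b} \<union> {a, b} \<times> {t1} \<union>
    {(t2, b), (t2, t1), (t2, a)}"
  have "generated (insert t2 A) (insert t1 A) E1"
    unfolding E1_def
  proof (rule generated_split[OF gen])
    show "Nl \<union> {a, b} = {n. (n, b) \<in> E}" using ab unfolding Nl_def by auto
    show "Nl \<inter> {a, b} = {}" "2 \<le> card Nl" "2 \<le> card {a, b}"
      using N ab Cl unfolding Nl_def by auto
  qed (use A tA ab in auto)
  \<comment> \<open>Pairs are reversed here in order to split the left copy of \<open>b\<close>:
    \<open>t3\<close> takes over its right neighbours \<open>t1\<close> and \<open>a\<close>, and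
    the new right vertex is \<open>t2\<close>.\<close>
  moreover define E2' where "E2' = {e \<in> E1\<inverse>. snd e \<noteq> b} \<union> Nr \<times> {b} \<union> {t1, a} \<times> {t3} \<union>
    {(t2, b), (t2, t3), (t2, t2)}"
  ultimately have "generated (insert t2 (insert t1 A)) (insert t3 (insert t2 A)) E2'"
    unfolding E2'_def
  proof (intro generated_split)
    show "generated (insert t1 A) (insert t2 A) (E1\<inverse>)"
      if "generated (insert t2 A) (insert t1 A) E1" using generated_swap[OF that] .
    show "Nr \<union> {t1, a} = {n. (n, b) \<in> E1\<inverse>}"
      using ab N t tE A tA unfolding E1_def Nr_def by auto
    show "Nr \<inter> {t1, a} = {}" "2 \<le> card Nr" "2 \<le> card {t1, a}"
      using N tA ne Cr unfolding Nr_def by auto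
  qed (use A t in auto)
  then have "generated (insert t3 (insert t2 A)) (insert t2 (insert t1 A)) (E2'\<inverse>)"
    by (rule generated_swap)
  moreover define E3 where "E3 = {e \<in> E2'\<inverse>. snd e \<noteq> a} \<union> Na \<times> {a} \<union> {t2, t3} \<times> {t3} \<union>
    {(t1, a), (t1, t3), (t1, t2)}"
  ultimately have "generated (insert t1 (insert t3 (insert t2 A))) (insert t3 (insert t2 (insert t1 A))) E3"
    unfolding E3_def
  proof (intro generated_split)
    show "Na \<union> {t2, t3} = {n. (n, a) \<in> E2'\<inverse>}"
      using ab N t tE A tA unfolding E2'_def E1_def Na_def by auto
    show "Na \<inter> {t2, t3} = {}" "2 \<le> card Na" "2 \<le> card {t2, t3}"
      using N tA ne cNa by auto
  qed (use A t in auto)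
  then have "generated (insert t1 (insert t3 (insert t2 A))) (insert t3 (insert t2 (insert t1 A)))
     (E3 \<union> {(t1, t1), (b, b)})"
    by (rule generated_add_subset) (use A in auto)
  moreover have "insert t1 (insert t3 (insert t2 A)) = A \<union> {t1, t2, t3}"
    "insert t3 (insert t2 (insert t1 A)) = A \<union> {t1, t2, t3}" by auto
  moreover have "E3 \<union> {(t1, t1), (b, b)} =
     E - {(a, b), (b, a)} \<union> {t1, t2, t3} \<times> {t1, t2, t3} \<union> {(a, t1), (t1, a), (t2, b), (b, t2)}"
  proof (rule set_eqI)
    fix e :: "'a \<times> 'a"
    obtain m n where e: "e = (m, n)" by (cases e)
    show "e \<in> E3 \<union> {(t1, t1), (b, b)} \<longleftrightarrow> e \<in> E - {(a, b), (b, a)} \<union>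
       {t1, t2, t3} \<times> {t1, t2, t3} \<union> {(a, t1), (t1, a), (t2, b), (b, t2)}"
    proof -
      have "m = t1 \<or> m = t2 \<or> m = t3 \<or> m = a \<or> m = b \<or> m \<notin> {t1, t2, t3, a, b}"
        "n = t1 \<or> n = t2 \<or> n = t3 \<or> n = a \<or> n = b \<or> n \<notin> {t1, t2, t3, a, b}" by blast+
      then show ?thesis
        unfolding e E3_def E2'_def E1_def Nl_def Nr_def Na_def
        by (elim disjE) (simp_all add: ne ne[symmetric] ab ab(1)[symmetric] tE)
    qed
  qed
  ultimately show ?thesis by simp
qed

section \<open>Ear decomposition\<close>

definition darts :: "'a ugraph \<Rightarrow> 'a set \<Rightarrow> ('a \<times> 'a) set" where
  "darts G W = (SIGMA v:W. nbrs G v)"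

text \<open>The pairs \<open>(x, x)\<close> are included: they are the loops, which make the three
  darts at a cubic vertex span a K3,3, the future hexagon. \<open>M\<close> is left arbitrary to
  allow links that are not edges of the given graph.\<close>

definition truncation :: "'a ugraph \<Rightarrow> 'a set \<Rightarrow> (('a \<times> 'a) \<times> ('a \<times> 'a)) set \<Rightarrow> (('a \<times> 'a) \<times> ('a \<times> 'a)) set" where
  "truncation G W M = {(x, y). x \<in> darts G W \<and> y \<in> darts G W \<and> fst x = fst y} \<union> M"

definition links :: "'a set set \<Rightarrow> (('a \<times> 'a) \<times> ('a \<times> 'a)) set" where
  "links F = {((u, v), (v, u)) |u v. {u, v} \<in> F}"

lemma truncation_eq_UN: "truncation G W M = (\<Union>v\<in>W. ({v} \<times> nbrs G v) \<times> ({v} \<times> nbrs G v)) \<union> M"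
  unfolding truncation_def darts_def by auto

lemma links_insert: "links (insert {x, y} F) = links F \<union> {((x, y), (y, x)), ((y, x), (x, y))}"
  unfolding links_def by (auto simp: doubleton_eq_iff)

text \<open>Built from the far end: a new vertex in \<open>W\<close> starts the path afresh, a
  repeated vertex cuts off a closed part, and any other vertex is put in front.\<close>

lemma rtrancl_first_hit:
  assumes "(u, p) \<in> R\<^sup>*" "p \<in> W"
  shows "\<exists>ys q. q \<in> W \<and> distinct ys \<and> set ys \<inter> W = {} \<and>
    successively (\<lambda>a b. (a, b) \<in> R) (ys @ [q]) \<and> hd (ys @ [q]) = u"
  using assms(1)
proof (induction rule: converse_rtrancl_induct)
  case base
  then show ?case using assms(2) by (intro exI[of _ "[]"] exI[of _ p]) auto
next
  case (step u z)
  then obtain ys q where ys: "q \<in> W" "distinct ys" "set ys \<inter> W = {}"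
    "successively (\<lambda>a b. (a, b) \<in> R) (ys @ [q])" "hd (ys @ [q]) = z" by blast
  consider "u \<in> W" | "u \<notin> W" "u \<in> set ys" | "u \<notin> W" "u \<notin> set ys" by blast
  then show ?case
  proof cases
    case 1
    then show ?thesis by (intro exI[of _ "[]"] exI[of _ u]) auto
  next
    case 2
    then obtain as bs where "ys = as @ u # bs" by (meson split_list)
    then show ?thesis using ys
      by (intro exI[of _ "u # bs"] exI[of _ q]) (auto simp: successively_append_iff)
  next
    case 3
    then show ?thesis using ys step.hyps
      by (intro exI[of _ "u # ys"] exI[of _ q]) (auto simp: successively_Cons)
  qed
qed

section \<open>Partial truncations of a bridgeless cubic graph\<close>

locale bridgeless_cubic =
  fixes G :: "'a ugraph"
  assumes simple: "simple_graph G" and connected: "connected_graph G"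
    and cubic: "cubic_graph G" and no_bridge: "bridgeless G"
begin

text \<open>The relation \<open>M\<close> matches darts, not necessarily reverse ones. The last clause says that at most one
  dart at each vertex is unmatched; it forces the two ends of an ear to be different.\<close>

definition buildable :: "'a set \<Rightarrow> (('a \<times> 'a) \<times> ('a \<times> 'a)) set \<Rightarrow> bool" where
  "buildable W M \<longleftrightarrow> W \<subseteq> uverts G \<and> M \<subseteq> darts G W \<times> darts G W \<and>
     generated (darts G W) (darts G W) (truncation G W M) \<and>
     (\<forall>w\<in>W. \<forall>u\<in>nbrs G w. \<forall>u'\<in>nbrs G w. (w, u) \<notin> Domain M \<longrightarrow> (w, u') \<notin> Domain M \<longrightarrow> u = u')"

lemma edge_sub: "{u, v} \<in> uedges G \<Longrightarrow> u \<in> uverts G \<and> v \<in> uverts G \<and> u \<noteq> v"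
  using simple unfolding simple_graph_def by fastforce

lemma nbrs_iff: "u \<in> nbrs G v \<longleftrightarrow> {v, u} \<in> uedges G"
  unfolding nbrs_def by simp

lemma card_nbrs: "v \<in> uverts G \<Longrightarrow> card (nbrs G v) = 3"
  using cubic unfolding cubic_graph_def vdegree_def by blast

lemma obtain_third:
  assumes "v \<in> uverts G" "x \<in> nbrs G v" "y \<in> nbrs G v" "x \<noteq> y"
  obtains z where "nbrs G v = {x, y, z}" "z \<noteq> x" "z \<noteq> y"
proof -
  have fin: "finite (nbrs G v)" using card_nbrs[OF assms(1)] by (simp add: card_ge_0_finite)
  then have "card (nbrs G v - {x, y}) = 1"
    using card_nbrs[OF assms(1)] assms by (simp add: card_Diff_subset)
  then obtain z where "nbrs G v - {x, y} = {z}" by (auto simp: card_1_singleton_iff)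
  then show ?thesis using assms that[of z] by blast
qed

lemma obtain_others:
  assumes "v \<in> uverts G" "x \<in> nbrs G v"
  obtains y z where "nbrs G v = {x, y, z}" "x \<noteq> y" "z \<noteq> x" "z \<noteq> y"
proof -
  have "nbrs G v \<noteq> {x}" using card_nbrs[OF assms(1)] by auto
  then obtain y where "y \<in> nbrs G v" "x \<noteq> y" using assms by blast
  then show ?thesis using obtain_third[OF assms(1,2)] that by metis
qed

text \<open>The darts need not be reverse to each other: otherwise the new link stands for an ear
  still to be built.\<close>

lemma buildable_join:
  assumes "buildable W M" "\<alpha> \<in> darts G W" "\<beta> \<in> darts G W"
  shows "buildable W (M \<union> {(\<alpha>, \<beta>), (\<beta>, \<alpha>)})"
proof -
  have gen: "generated (darts G W) (darts G W) (truncation G W M)"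
    using assms unfolding buildable_def by blast
  have "generated (darts G W) (darts G W) (truncation G W M \<union> {(\<alpha>, \<beta>), (\<beta>, \<alpha>)})"
    by (rule generated_add_subset[OF gen]) (use assms in auto)
  moreover have "truncation G W M \<union> {(\<alpha>, \<beta>), (\<beta>, \<alpha>)} = truncation G W (M \<union> {(\<alpha>, \<beta>), (\<beta>, \<alpha>)})"
    unfolding truncation_def by blast
  ultimately show ?thesis using assms unfolding buildable_def by auto
qed

text \<open>The triangle of darts at \<open>v\<close> subdivides the link between \<alpha> and
  \<beta>. Since these lie at different vertices, no triangle edge is removed, and the other darts
  at their vertices supply the neighbours that the splittings need. Only the third dart at
  \<open>v\<close> stays unmatched.\<close>

lemma buildable_insert_vertex:
  assumes st: "buildable W M" and ab: "(\<alpha>, \<beta>) \<in> M" "(\<beta>, \<alpha>) \<in> M" "fst \<alpha> \<noteq> fst \<beta>"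
    and v: "v \<in> uverts G" "v \<notin> W" and xy: "x \<in> nbrs G v" "y \<in> nbrs G v" "x \<noteq> y"
  shows "buildable (insert v W) (M - {(\<alpha>, \<beta>), (\<beta>, \<alpha>)} \<union>
    {(\<alpha>, (v, x)), ((v, x), \<alpha>), ((v, y), \<beta>), (\<beta>, (v, y))})" (is "buildable _ ?M")
proof -
  have W: "W \<subseteq> uverts G" and MW: "M \<subseteq> darts G W \<times> darts G W"
    and gen: "generated (darts G W) (darts G W) (truncation G W M)"
    and one: "\<And>w u u'. w \<in> W \<Longrightarrow> u \<in> nbrs G w \<Longrightarrow> u' \<in> nbrs G w \<Longrightarrow>
      (w, u) \<notin> Domain M \<Longrightarrow> (w, u') \<notin> Domain M \<Longrightarrow> u = u'"
    using st unfolding buildable_def by blast+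
  obtain z where z: "nbrs G v = {x, y, z}" "z \<noteq> x" "z \<noteq> y"
    using obtain_third[OF v(1) xy] by blast
  have dart: "\<alpha> \<in> darts G W" "\<beta> \<in> darts G W" using ab MW by auto
  obtain p s where \<alpha>: "\<alpha> = (p, s)" by (cases \<alpha>)
  obtain q r where \<beta>: "\<beta> = (q, r)" by (cases \<beta>)
  have pq: "p \<in> W" "s \<in> nbrs G p" "q \<in> W" "r \<in> nbrs G q" "p \<noteq> q"
    using dart ab(3) unfolding \<alpha> \<beta> darts_def by auto
  obtain r1 r2 where r: "nbrs G q = {r, r1, r2}" "r \<noteq> r1" "r2 \<noteq> r" "r2 \<noteq> r1"
    using obtain_others[of q r] pq W by blast
  obtain s1 s2 where s: "nbrs G p = {s, s1, s2}" "s \<noteq> s1" "s2 \<noteq> s" "s2 \<noteq> s1"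
    using obtain_others[of p s] pq W by blast
  note fin = generated_finite(1)[OF gen]
  have TW: "truncation G W M \<subseteq> darts G W \<times> darts G W" using MW unfolding truncation_def by auto
  have two: "card N \<ge> 2" if "{(q, r1), (q, r2)} \<subseteq> N" "N \<subseteq> darts G W" for N
  proof -
    have "finite N" using that(2) fin by (rule finite_subset)
    then have "card {(q, r1), (q, r2)} \<le> card N" using that(1) by (intro card_mono)
    then show ?thesis using r by simp
  qed
  have mem: "(q, r1) \<in> darts G W" "(q, r2) \<in> darts G W" "(q, r) \<in> darts G W"
    "(p, s) \<in> darts G W" "(p, s1) \<in> darts G W"
    using pq r s unfolding darts_def by auto
  have dv: "darts G (insert v W) = darts G W \<union> {(v, x), (v, y), (v, z)}"
    using z unfolding darts_def by auto
  have nv: "(v, n) \<notin> darts G W" for n using v unfolding darts_def by auto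
  have "generated (darts G W \<union> {(v, x), (v, y), (v, z)}) (darts G W \<union> {(v, x), (v, y), (v, z)})
    (truncation G W M - {(\<alpha>, \<beta>), (\<beta>, \<alpha>)} \<union> {(v, x), (v, y), (v, z)} \<times> {(v, x), (v, y), (v, z)} \<union>
      {(\<alpha>, (v, x)), ((v, x), \<alpha>), ((v, y), \<beta>), (\<beta>, (v, y))})"
  proof (rule generated_insert_triangle[OF gen, where c = "(p, s1)"])
    show "\<alpha> \<noteq> \<beta>" "(p, s1) \<noteq> \<alpha>" "(p, s1) \<noteq> \<beta>" using pq s unfolding \<alpha> \<beta> by auto
    show "(\<alpha>, \<alpha>) \<in> truncation G W M" "(\<beta>, \<beta>) \<in> truncation G W M" "(\<alpha>, \<beta>) \<in> truncation G W M"
      "(\<beta>, \<alpha>) \<in> truncation G W M" "((p, s1), \<alpha>) \<in> truncation G W M"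
      using dart ab mem unfolding truncation_def \<alpha> by auto
    show "2 \<le> card {n. (n, \<beta>) \<in> truncation G W M \<and> n \<noteq> \<alpha> \<and> n \<noteq> \<beta>}"
      by (rule two) (use TW mem pq r in \<open>auto simp: \<alpha> \<beta> truncation_def\<close>)
    show "2 \<le> card {n. (\<beta>, n) \<in> truncation G W M \<and> n \<noteq> \<alpha> \<and> n \<noteq> \<beta>}"
      by (rule two) (use TW mem pq r in \<open>auto simp: \<alpha> \<beta> truncation_def\<close>)
    show "distinct [(v, x), (v, y), (v, z)]" using xy z by auto
    show "{(v, x), (v, y), (v, z)} \<inter> darts G W = {}" using nv by blast
  qed
  moreover have "truncation G W M - {(\<alpha>, \<beta>), (\<beta>, \<alpha>)} \<union> {(v, x), (v, y), (v, z)} \<times> {(v, x), (v, y), (v, z)} \<union>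
      {(\<alpha>, (v, x)), ((v, x), \<alpha>), ((v, y), \<beta>), (\<beta>, (v, y))} = truncation G (insert v W) ?M"
  proof -
    define T where "T = (\<Union>v\<in>W. ({v} \<times> nbrs G v) \<times> ({v} \<times> nbrs G v))"
    have disj: "{(\<alpha>, \<beta>), (\<beta>, \<alpha>)} \<inter> T = {}" using ab(3) unfolding T_def by auto
    have N: "{v} \<times> nbrs G v = {(v, x), (v, y), (v, z)}" using z by auto
    have sets: "T \<union> M - P \<union> S \<union> Q = (S \<union> T) \<union> (M - P \<union> Q)" if "P \<inter> T = {}" for P S Q
      using that by blast
    show ?thesis unfolding truncation_eq_UN UN_insert T_def[symmetric] N by (rule sets[OF disj])
  qed
  ultimately have g: "generated (darts G (insert v W)) (darts G (insert v W)) (truncation G (insert v W) ?M)"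
    by (simp add: dv)
  have D: "darts G W \<subseteq> darts G (insert v W)" "(v, x) \<in> darts G (insert v W)"
    "(v, y) \<in> darts G (insert v W)" unfolding dv by auto
  have M_sub: "?M \<subseteq> darts G (insert v W) \<times> darts G (insert v W)"
  proof (intro Un_least)
    show "M - {(\<alpha>, \<beta>), (\<beta>, \<alpha>)} \<subseteq> darts G (insert v W) \<times> darts G (insert v W)"
      using MW D(1) by (meson Diff_subset Sigma_mono order_trans)
    show "{(\<alpha>, (v, x)), ((v, x), \<alpha>), ((v, y), \<beta>), (\<beta>, (v, y))} \<subseteq>
        darts G (insert v W) \<times> darts G (insert v W)"
      using D(2,3) subsetD[OF D(1) dart(1)] subsetD[OF D(1) dart(2)] by simp
  qed
  have one': "u = u'" if w: "w \<in> insert v W" "u \<in> nbrs G w" "u' \<in> nbrs G w"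
    and d: "(w, u) \<notin> Domain ?M" "(w, u') \<notin> Domain ?M" for w u u'
  proof (cases "w = v")
    case True
    then show ?thesis using w d z by auto
  next
    case False
    \<comment> \<open>\<alpha> and \<beta> lose their common link but are matched again with darts
      at \<open>v\<close>.\<close>
    have "Domain M \<subseteq> Domain ?M" by auto
    then have "(w, u) \<notin> Domain M" "(w, u') \<notin> Domain M" using d by (meson subsetD)+
    then show ?thesis using one[of w u u'] w False by simp
  qed
  show ?thesis
    unfolding buildable_def
  proof (intro conjI ballI impI)
    show "insert v W \<subseteq> uverts G" using W v by simp
  qed (use g M_sub one' in simp_all)
qed

text \<open>The darts \<open>(x, hd (ys @ [q]))\<close> and \<open>(q, last (x # ys))\<close> are those of the path \<open>x ys q\<close> at its
  ends; being matched, they stand for the part of the ear that is not built yet.\<close>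

lemma buildable_ear:
  assumes "buildable W (links F \<union> {((x, hd (ys @ [q])), (q, last (x # ys))), ((q, last (x # ys)), (x, hd (ys @ [q])))})"
    and "F \<subseteq> uedges G" "x \<in> W" "q \<in> W" "x \<noteq> q" "distinct ys" "set ys \<inter> W = {}"
    and "successively (\<lambda>a b. {a, b} \<in> uedges G) (x # ys @ [q])"
  shows "\<exists>F'. insert {x, hd (ys @ [q])} F \<subseteq> F' \<and> F' \<subseteq> uedges G \<and> buildable (W \<union> set ys) (links F')"
  using assms
proof (induction ys arbitrary: x W F)
  case Nil
  \<comment> \<open>With no inner vertex left, the pending link is the genuine link of the edge from
    \<open>x\<close> to \<open>q\<close>.\<close>
  then have "buildable W (links (insert {x, q} F))" by (simp add: links_insert)
  then show ?case using Nil by (intro exI[of _ "insert {x, q} F"]) auto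
next
  case (Cons y ys)
  let ?y' = "hd (ys @ [q])" and ?\<beta> = "(q, last (y # ys))"
  let ?M = "links F \<union> {((x, y), ?\<beta>), (?\<beta>, (x, y))}"
  have st: "buildable W ?M" using Cons.prems(1) by simp
  have y: "y \<notin> W" "y \<notin> set ys" "y \<noteq> q" using Cons.prems by auto
  have xy: "{x, y} \<in> uedges G" and succ: "successively (\<lambda>a b. {a, b} \<in> uedges G) (y # ys @ [q])"
    using Cons.prems(8) by auto
  have y': "{y, ?y'} \<in> uedges G" using succ by (cases ys) auto
  \<comment> \<open>The path must enter and leave \<open>y\<close> through different darts.\<close>
  have "?y' \<noteq> x" using Cons.prems by (cases ys) auto
  then have "buildable (insert y W) (?M - {((x, y), ?\<beta>), (?\<beta>, (x, y))} \<union>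
      {((x, y), (y, x)), ((y, x), (x, y)), ((y, ?y'), ?\<beta>), (?\<beta>, (y, ?y'))})"
    using Cons.prems(5) y xy y' edge_sub
    by (intro buildable_insert_vertex[OF st]) (auto simp: nbrs_iff insert_commute)
  \<comment> \<open>As \<open>y\<close> differs from \<open>q\<close>, the pending link joins darts
    that are not reverse to each other, so removing it leaves \<open>links F\<close> intact.\<close>
  moreover have "((x, y), ?\<beta>) \<notin> links F" "(?\<beta>, (x, y)) \<notin> links F"
    using y unfolding links_def by auto
  then have "?M - {((x, y), ?\<beta>), (?\<beta>, (x, y))} \<union>
      {((x, y), (y, x)), ((y, x), (x, y)), ((y, ?y'), ?\<beta>), (?\<beta>, (y, ?y'))} =
      links (insert {x, y} F) \<union> {((y, ?y'), ?\<beta>), (?\<beta>, (y, ?y'))}"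
    unfolding links_insert by blast
  ultimately have "buildable (insert y W) (links (insert {x, y} F) \<union> {((y, ?y'), ?\<beta>), (?\<beta>, (y, ?y'))})"
    by simp
  then obtain F' where "insert {y, ?y'} (insert {x, y} F) \<subseteq> F'" "F' \<subseteq> uedges G"
    "buildable (insert y W \<union> set ys) (links F')"
    using Cons.IH[of "insert y W" "insert {x, y} F" y] Cons.prems y xy succ by auto
  then show ?case by (intro exI[of _ F']) auto
qed

text \<open>The edge from \<open>p\<close> to \<open>u\<close> is no bridge, so \<open>u\<close>
  reaches \<open>p\<close> without it; the path is stopped at its first vertex in
  \<open>W\<close>.\<close>

lemma path_avoiding_edge:
  assumes e: "{p, u} \<in> uedges G" and W: "p \<in> W" "u \<notin> W"
  obtains ys q where "q \<in> W" "distinct (u # ys)" "set (u # ys) \<inter> W = {}"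
    "successively (\<lambda>a b. {a, b} \<in> uedges G) (u # ys @ [q])"
    "{last (u # ys), q} \<in> uedges G" "{last (u # ys), q} \<noteq> {p, u}"
proof -
  let ?R = "{(x, y). {x, y} \<in> uedges (delete_edge G {p, u})}"
  have "joined (delete_edge G {p, u}) u p"
    using no_bridge e unfolding bridgeless_def bridge_def by (metis insert_commute)
  then have "(u, p) \<in> ?R\<^sup>*" unfolding joined_def .
  from rtrancl_first_hit[OF this W(1)] obtain zs q where zs: "q \<in> W" "distinct zs" "set zs \<inter> W = {}"
    "successively (\<lambda>a b. (a, b) \<in> ?R) (zs @ [q])" "hd (zs @ [q]) = u" by blast
  then obtain ys where ys: "zs = u # ys" using W by (cases zs) auto
  have "successively (\<lambda>a b. {a, b} \<in> uedges G) (u # ys @ [q])"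
    using zs(4) unfolding ys by (auto simp: delete_edge_def elim: successively_mono)
  moreover have "zs \<noteq> []" using ys by simp
  then have "(last zs, q) \<in> ?R" using zs(4) by (simp add: successively_append_iff)
  ultimately show ?thesis using that[of q ys] zs ys by (auto simp: delete_edge_def)
qed

lemma buildable_initial:
  obtains W F where "W \<noteq> {}" "F \<subseteq> uedges G" "buildable W (links F)"
proof -
  obtain a where a: "a \<in> uverts G" using connected unfolding connected_graph_def by blast
  then have "nbrs G a \<noteq> {}" using card_nbrs by fastforce
  then obtain b where ab: "{a, b} \<in> uedges G" by (auto simp: nbrs_iff)
  then have b: "b \<in> uverts G" "a \<noteq> b" using edge_sub by auto
  \<comment> \<open>With \<open>{a}\<close> as the target set the path returns to \<open>a\<close>
    and closes a cycle with the edge from \<open>a\<close> to \<open>b\<close>.\<close>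
  obtain ys q where "q \<in> {a}" and ys: "distinct (b # ys)" "set (b # ys) \<inter> {a} = {}"
    "successively (\<lambda>a b. {a, b} \<in> uedges G) (b # ys @ [q])"
    "{last (b # ys), q} \<in> uedges G" "{last (b # ys), q} \<noteq> {a, b}"
    by (rule path_avoiding_edge[OF ab, of "{a}"]) (use b in blast)+
  then have q: "q = a" by simp
  have "ys \<noteq> []" using ys(5) q by auto
  let ?c = "last ys" and ?d = "hd ys"
  have c: "?c \<in> nbrs G a" "?c \<noteq> b" and d: "?d \<in> nbrs G b" "?d \<noteq> a"
    using ys q \<open>ys \<noteq> []\<close> by (auto simp: nbrs_iff insert_commute successively_Cons hd_append)
  obtain a0 where a0: "nbrs G a = {b, ?c, a0}" "a0 \<noteq> b" "a0 \<noteq> ?c"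
    using obtain_third[OF a, of b ?c] ab c by (metis nbrs_iff)
  obtain b0 where b0: "nbrs G b = {a, ?d, b0}" "b0 \<noteq> a" "b0 \<noteq> ?d"
    using obtain_third[OF b(1), of a ?d] ab d by (metis nbrs_iff insert_commute)
  \<comment> \<open>The second link is pending: it stands for the rest of the cycle, the path from
    \<open>b\<close> through \<open>ys\<close> to \<open>a\<close>.\<close>
  let ?M = "links {{a, b}} \<union> {((b, ?d), (a, ?c)), ((a, ?c), (b, ?d))}"
  have D: "darts G {a, b} = {(a, a0), (a, b), (a, ?c), (b, b0), (b, a), (b, ?d)}"
    using a0 b0 b(2) unfolding darts_def by auto
  have L: "links {{a, b}} = {((a, b), (b, a)), ((b, a), (a, b))}"
    using links_insert[of a b "{}"] by (simp add: links_def)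
  have "generated {(a, a0), (a, b), (a, ?c), (b, b0), (b, a), (b, ?d)}
     {(a, a0), (a, b), (a, ?c), (b, b0), (b, a), (b, ?d)}
     ({(a, a0), (a, b), (a, ?c)} \<times> {(a, a0), (a, b), (a, ?c)} \<union>
      {(b, b0), (b, a), (b, ?d)} \<times> {(b, b0), (b, a), (b, ?d)} \<union>
      {((a, b), (b, a)), ((b, a), (a, b)), ((a, ?c), (b, ?d)), ((b, ?d), (a, ?c))})"
    using a0 b0 b(2) c d by (intro generated_two_triangles) auto
  moreover have "{(a, a0), (a, b), (a, ?c)} \<times> {(a, a0), (a, b), (a, ?c)} \<union>
      {(b, b0), (b, a), (b, ?d)} \<times> {(b, b0), (b, a), (b, ?d)} \<union>
      {((a, b), (b, a)), ((b, a), (a, b)), ((a, ?c), (b, ?d)), ((b, ?d), (a, ?c))} =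
      truncation G {a, b} ?M"
  proof -
    have "{a} \<times> nbrs G a = {(a, a0), (a, b), (a, ?c)}" "{b} \<times> nbrs G b = {(b, b0), (b, a), (b, ?d)}"
      using a0 b0 by auto
    then show ?thesis unfolding truncation_eq_UN L by (simp add: Un_ac insert_commute)
  qed
  ultimately have g: "generated (darts G {a, b}) (darts G {a, b}) (truncation G {a, b} ?M)"
    unfolding D by simp
  have M_sub: "?M \<subseteq> darts G {a, b} \<times> darts G {a, b}" unfolding D L by auto
  have one: "u = u'" if "w \<in> {a, b}" "u \<in> nbrs G w" "u' \<in> nbrs G w"
    "(w, u) \<notin> Domain ?M" "(w, u') \<notin> Domain ?M" for w u u'
    using that a0(1) b0(1) unfolding L by auto
  have st: "buildable {a, b} ?M"
    unfolding buildable_def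
  proof (intro conjI ballI impI)
    show "{a, b} \<subseteq> uverts G" using a b by simp
  qed (fact g M_sub | rule one; assumption)+
  have "\<exists>F'. insert {b, hd (ys @ [a])} {{a, b}} \<subseteq> F' \<and> F' \<subseteq> uedges G \<and>
     buildable ({a, b} \<union> set ys) (links F')"
    by (rule buildable_ear) (use st ys \<open>ys \<noteq> []\<close> ab b q in \<open>auto\<close>)
  then obtain F' where "F' \<subseteq> uedges G" "buildable ({a, b} \<union> set ys) (links F')" by blast
  then show ?thesis by (intro that) auto
qed

text \<open>Some missing edge has an end in \<open>W\<close>. If both ends lie in \<open>W\<close>
  it is added directly; otherwise it begins an ear.\<close>

lemma buildable_extend:
  assumes st: "buildable W (links F)" and W: "W \<noteq> {}" and F: "F \<subseteq> uedges G" "F \<noteq> uedges G"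
  shows "\<exists>W' F'. W' \<noteq> {} \<and> F \<subset> F' \<and> F' \<subseteq> uedges G \<and> buildable W' (links F')"
proof -
  have WV: "W \<subseteq> uverts G" and MW: "links F \<subseteq> darts G W \<times> darts G W"
    and one: "\<And>w u u'. w \<in> W \<Longrightarrow> u \<in> nbrs G w \<Longrightarrow> u' \<in> nbrs G w \<Longrightarrow>
      (w, u) \<notin> Domain (links F) \<Longrightarrow> (w, u') \<notin> Domain (links F) \<Longrightarrow> u = u'"
    using st unfolding buildable_def by blast+
  have FW: "u \<in> W" if "{u, v} \<in> F" for u v
    using that MW unfolding links_def darts_def by blast
  have dom: "(u, v) \<in> Domain (links F) \<longleftrightarrow> {u, v} \<in> F" for u v
    unfolding links_def by auto
  \<comment> \<open>Otherwise \<open>W\<close> would be closed under adjacency, hence contain all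
    vertices by connectedness, and \<open>F\<close> would contain all edges.\<close>
  have "\<exists>p u. p \<in> W \<and> {p, u} \<in> uedges G \<and> {p, u} \<notin> F"
  proof (rule ccontr)
    assume "\<not> ?thesis"
    then have all: "{p, u} \<in> F" if "p \<in> W" "{p, u} \<in> uedges G" for p u using that by blast
    obtain p where p: "p \<in> W" using W by blast
    have "v \<in> W" if "v \<in> uverts G" for v
    proof -
      have "joined G p v" using connected that p WV unfolding connected_graph_def by blast
      then have "(p, v) \<in> {(x, y). {x, y} \<in> uedges G}\<^sup>*" unfolding joined_def .
      then show ?thesis
      proof induction
        case base
        then show ?case using p .
      next
        case (step y z)
        then have "{z, y} \<in> F" using all[of y z] by (simp add: insert_commute)
        then show ?case using FW by blast
      qed
    qed
    moreover have "\<exists>x y. e = {x, y}" if "e \<in> uedges G" for e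
      using that simple unfolding simple_graph_def by (meson card_2_iff)
    ultimately have "uedges G \<subseteq> F" using all edge_sub by blast
    then show False using F by blast
  qed
  then obtain p u where pu: "p \<in> W" "{p, u} \<in> uedges G" "{p, u} \<notin> F" by blast
  show ?thesis
  proof (cases "u \<in> W")
    case True
    have "buildable W (links F \<union> {((p, u), (u, p)), ((u, p), (p, u))})"
      using pu True by (intro buildable_join[OF st]) (auto simp: darts_def nbrs_iff insert_commute)
    then have "buildable W (links (insert {p, u} F))" by (simp add: links_insert)
    then show ?thesis using pu F W by (intro exI[of _ W] exI[of _ "insert {p, u} F"]) auto
  next
    case False
    obtain ys q where ys: "q \<in> W" "distinct (u # ys)" "set (u # ys) \<inter> W = {}"
      "successively (\<lambda>a b. {a, b} \<in> uedges G) (u # ys @ [q])"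
      "{last (u # ys), q} \<in> uedges G" "{last (u # ys), q} \<noteq> {p, u}"
      by (rule path_avoiding_edge[OF pu(2,1) False])
    let ?l = "last (u # ys)"
    have l: "?l \<notin> W" using ys(3) last_in_set[of "u # ys"] by blast
    \<comment> \<open>If the ear returned to \<open>p\<close>, its first and last darts at
      \<open>p\<close> would both be unmatched, hence equal, and the path would end with the edge it
      avoids.\<close>
    have "p \<noteq> q"
    proof
      assume "p = q"
      then have "{p, ?l} \<notin> F" using FW[of ?l p] l by (metis insert_commute)
      then have "?l = u"
        using one[OF pu(1), of ?l u] pu ys(5) \<open>p = q\<close> unfolding dom
        by (simp add: nbrs_iff insert_commute)
      then show False using ys(6) \<open>p = q\<close> by (metis insert_commute)
    qed
    have "buildable W (links F \<union> {((p, u), (q, ?l)), ((q, ?l), (p, u))})"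
      using pu ys(1,5) by (intro buildable_join[OF st]) (auto simp: darts_def nbrs_iff insert_commute)
    then have "\<exists>F'. insert {p, hd ((u # ys) @ [q])} F \<subseteq> F' \<and> F' \<subseteq> uedges G \<and>
        buildable (W \<union> set (u # ys)) (links F')"
      using pu F ys \<open>p \<noteq> q\<close> by (intro buildable_ear) auto
    then obtain F' where "insert {p, u} F \<subseteq> F'" "F' \<subseteq> uedges G" "buildable (W \<union> set (u # ys)) (links F')"
      by auto
    then show ?thesis using pu W by (intro exI[of _ "W \<union> set (u # ys)"] exI[of _ F']) auto
  qed
qed

lemma truncation_generated:
  "generated (darts G (uverts G)) (darts G (uverts G)) (truncation G (uverts G) (links (uedges G)))"
proof -
  have "uedges G \<subseteq> Pow (uverts G)" "finite (uverts G)" using simple unfolding simple_graph_def by auto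
  then have fin: "finite (uedges G)" by (simp add: finite_subset)
  have complete: "\<exists>W. buildable W (links (uedges G))"
    if "buildable W (links F)" "W \<noteq> {}" "F \<subseteq> uedges G" for W F
    using that
  proof (induction "card (uedges G - F)" arbitrary: W F rule: less_induct)
    case less
    show ?case
    proof (cases "F = uedges G")
      case True
      then show ?thesis using less.prems by blast
    next
      case False
      then obtain W' F' where W': "W' \<noteq> {}" "F \<subset> F'" "F' \<subseteq> uedges G" "buildable W' (links F')"
        using buildable_extend[OF less.prems False] by (elim exE conjE)
      then have "card (uedges G - F') < card (uedges G - F)"
        using fin by (intro psubset_card_mono) auto
      then show ?thesis by (rule less.hyps[OF _ W'(4,1,3)])
    qed
  qed
  obtain W0 F0 where W0: "W0 \<noteq> {}" "F0 \<subseteq> uedges G" "buildable W0 (links F0)" by (rule buildable_initial)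
  from complete[OF W0(3,1,2)] obtain W where W: "buildable W (links (uedges G))" ..
  \<comment> \<open>Linked darts lie at vertices of \<open>W\<close>, and every vertex has a dart
    that is linked once all edges are.\<close>
  have "v \<in> W" if v: "v \<in> uverts G" for v
  proof -
    have "nbrs G v \<noteq> {}" using card_nbrs[OF v] by fastforce
    then obtain u where "{v, u} \<in> uedges G" by (auto simp: nbrs_iff)
    then have "((v, u), (u, v)) \<in> links (uedges G)" unfolding links_def by blast
    then have "(v, u) \<in> darts G W" using W unfolding buildable_def by blast
    then show ?thesis unfolding darts_def by simp
  qed
  moreover have "W \<subseteq> uverts G" using W unfolding buildable_def by simp
  ultimately have "W = uverts G" by blast
  then show ?thesis using W unfolding buildable_def by simp
qed

end

section \<open>The hexagon graph\<close>

text \<open>Of the two hexagon vertices with indices \<open>i\<close> and \<open>i + 3\<close> belonging to a dart, exactly one lies in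
  \<open>X\<close> and one in \<open>Y\<close>.\<close>

definition hexX :: "('a \<Rightarrow> 'a \<Rightarrow> nat) \<Rightarrow> 'a \<times> 'a \<Rightarrow> 'a \<times> nat" where
  "hexX idx d = (fst d, if even (idx (fst d) (snd d)) then idx (fst d) (snd d)
     else (idx (fst d) (snd d) + 3) mod 6)"

definition hexY :: "('a \<Rightarrow> 'a \<Rightarrow> nat) \<Rightarrow> 'a \<times> 'a \<Rightarrow> 'a \<times> nat" where
  "hexY idx d = (fst d, if even (idx (fst d) (snd d)) then (idx (fst d) (snd d) + 3) mod 6
     else idx (fst d) (snd d))"

text \<open>The parity test in \<open>link_edges\<close> only ensures that each of the two edges
  runs from \<open>X\<close> to \<open>Y\<close>; in terms of \<open>hexX\<close> and
  \<open>hexY\<close> it disappears.\<close>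

lemma link_edges_eq:
  "link_edges idx u v = {{hexX idx (u, v), hexY idx (v, u)}, {hexX idx (v, u), hexY idx (u, v)}}"
  by (auto simp: link_edges_def hexX_def hexY_def Let_def insert_commute)

lemma residues_mod_6: "i < (6::nat) \<longleftrightarrow> i \<in> {0, 1, 2, 3, 4, 5}"
  by auto

context bridgeless_cubic
begin

lemma hexagon_indexing_image:
  assumes "hexagon_indexing G idx" "v \<in> uverts G"
  shows "idx v ` nbrs G v = {0, 1, 2}"
proof -
  have i: "idx v ` nbrs G v \<subseteq> {0, 1, 2}" "inj_on (idx v) (nbrs G v)"
    using assms unfolding hexagon_indexing_def by auto
  then have "card (idx v ` nbrs G v) = card {0, 1, 2::nat}"
    using card_nbrs[OF assms(2)] by (simp add: card_image)
  then show ?thesis using i(1) by (intro card_subset_eq) auto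
qed

text \<open>The indices 0, 1, 2 yield 0, 4, 2 in \<open>X\<close> and 3, 1, 5 in
  \<open>Y\<close>.\<close>

lemma hexagon_sides:
  assumes "hexagon_indexing G idx" "v \<in> uverts G"
  shows "hexX idx ` ({v} \<times> nbrs G v) = {v} \<times> {0, 2, 4}"
    and "hexY idx ` ({v} \<times> nbrs G v) = {v} \<times> {1, 3, 5}"
proof -
  let ?e = "\<lambda>i::nat. if even i then i else (i + 3) mod 6"
  let ?o = "\<lambda>i::nat. if even i then (i + 3) mod 6 else i"
  have "hexX idx ` ({v} \<times> nbrs G v) = (\<lambda>i. (v, ?e i)) ` idx v ` nbrs G v"
    "hexY idx ` ({v} \<times> nbrs G v) = (\<lambda>i. (v, ?o i)) ` idx v ` nbrs G v"
    by (auto simp: hexX_def hexY_def image_iff)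
  then show "hexX idx ` ({v} \<times> nbrs G v) = {v} \<times> {0, 2, 4}"
    "hexY idx ` ({v} \<times> nbrs G v) = {v} \<times> {1, 3, 5}"
    unfolding hexagon_indexing_image[OF assms] by auto
qed

lemma hexagon_sides_inj:
  assumes "hexagon_indexing G idx"
  shows "inj_on (hexX idx) (darts G (uverts G))" "inj_on (hexY idx) (darts G (uverts G))"
proof -
  have idx: "idx v u \<in> {0, 1, 2}" "inj_on (idx v) (nbrs G v)" if "v \<in> uverts G" "u \<in> nbrs G v" for u v
    using assms that unfolding hexagon_indexing_def by blast+
  show "inj_on (hexX idx) (darts G (uverts G))"
  proof (rule inj_onI)
    fix d d' assume d: "d \<in> darts G (uverts G)" "d' \<in> darts G (uverts G)" "hexX idx d = hexX idx d'"
    obtain v u u' where vu: "d = (v, u)" "d' = (v, u')" using d(3) unfolding hexX_def by (cases d; cases d') auto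
    then have v: "v \<in> uverts G" "u \<in> nbrs G v" "u' \<in> nbrs G v" using d unfolding darts_def by auto
    have "idx v u = idx v u'" using d(3) idx(1)[OF v(1,2)] idx(1)[OF v(1,3)] unfolding vu hexX_def by auto
    then show "d = d'" using inj_onD[OF idx(2)[OF v(1,2)]] v vu by blast
  qed
  show "inj_on (hexY idx) (darts G (uverts G))"
  proof (rule inj_onI)
    fix d d' assume d: "d \<in> darts G (uverts G)" "d' \<in> darts G (uverts G)" "hexY idx d = hexY idx d'"
    obtain v u u' where vu: "d = (v, u)" "d' = (v, u')" using d(3) unfolding hexY_def by (cases d; cases d') auto
    then have v: "v \<in> uverts G" "u \<in> nbrs G v" "u' \<in> nbrs G v" using d unfolding darts_def by auto
    have "idx v u = idx v u'" using d(3) idx(1)[OF v(1,2)] idx(1)[OF v(1,3)] unfolding vu hexY_def by auto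
    then show "d = d'" using inj_onD[OF idx(2)[OF v(1,2)]] v vu by blast
  qed
qed

lemma hexagon_graph_rep:
  assumes "hexagon_indexing G idx"
  shows "bip_rep (darts G (uverts G)) (darts G (uverts G)) (truncation G (uverts G) (links (uedges G)))
    (hexX idx) (hexY idx) (hexagon_graph G idx)"
proof -
  let ?V = "uverts G" and ?h = "\<lambda>(a, b). {hexX idx a, hexY idx b}"
  have D: "darts G ?V = (\<Union>v\<in>?V. {v} \<times> nbrs G v)" unfolding darts_def by auto
  have X: "hexX idx ` darts G ?V = ?V \<times> {0, 2, 4}" and Y: "hexY idx ` darts G ?V = ?V \<times> {1, 3, 5}"
    unfolding D image_UN using hexagon_sides[OF assms] by auto
  have sub: "truncation G ?V (links (uedges G)) \<subseteq> darts G ?V \<times> darts G ?V"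
    unfolding truncation_def links_def darts_def
    by (auto simp: nbrs_iff insert_commute dest: edge_sub)
  have V: "uverts (hexagon_graph G idx) = hexX idx ` darts G ?V \<union> hexY idx ` darts G ?V"
    unfolding X Y by (auto simp: hexagon_graph_def residues_mod_6)
  have h: "?h ` (({v} \<times> nbrs G v) \<times> ({v} \<times> nbrs G v)) = (\<lambda>(i, j). {(v, i), (v, j)}) ` ({0, 2, 4 :: nat} \<times> {1, 3, 5 :: nat})"
    if "v \<in> ?V" for v
  proof -
    have h_Times: "?h ` (A \<times> B) = (\<lambda>(x, y). {x, y}) ` (hexX idx ` A \<times> hexY idx ` B)" for A B
      by (force simp: image_iff)
    have v_Times: "(\<lambda>(x, y). {x, y}) ` (({v} \<times> P) \<times> ({v} \<times> Q)) = (\<lambda>(i, j). {(v, i), (v, j)}) ` (P \<times> Q)"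
      for P Q :: "nat set"
      by (force simp: image_iff)
    show ?thesis unfolding h_Times hexagon_sides[OF assms that] v_Times ..
  qed
  \<comment> \<open>The six cycle edges and three diagonals of a hexagon are all nine pairs of an
    even and an odd residue; each diagonal is listed twice on the left.\<close>
  have hex: "{{(v, i), (v, (i + 1) mod 6)} |i. i < (6::nat)} \<union> {{(v, i), (v, (i + 3) mod 6)} |i. i < (6::nat)} =
    (\<lambda>(i, j). {(v, i), (v, j)}) ` ({0, 2, 4 :: nat} \<times> {1, 3, 5 :: nat})" (is "?A \<union> ?B = ?C") for v :: 'a
  proof -
    have "?A = (\<lambda>i. {(v, i), (v, (i + 1) mod 6)}) ` {0, 1, 2, 3, 4, 5}"
      "?B = (\<lambda>i. {(v, i), (v, (i + 3) mod 6)}) ` {0, 1, 2, 3, 4, 5}"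
      unfolding residues_mod_6 by (simp_all only: Setcompr_eq_image Collect_mem_eq)
    then have AB: "?A \<union> ?B = {{(v, 0), (v, 3)}, {(v, 1), (v, 4)}, {(v, 2), (v, 5)}, {(v, 3), (v, 0)},
        {(v, 4), (v, 1)}, {(v, 5), (v, 2)}, {(v, 0), (v, 1)}, {(v, 1), (v, 2)}, {(v, 2), (v, 3)},
        {(v, 3), (v, 4)}, {(v, 4), (v, 5)}, {(v, 5), (v, 0)}}"
      by (simp flip: numeral_2_eq_2)
    have C: "?C = {{(v, 0), (v, 1)}, {(v, 0), (v, 3)}, {(v, 0), (v, 5)}, {(v, 2), (v, 1)},
        {(v, 2), (v, 3)}, {(v, 2), (v, 5)}, {(v, 4), (v, 1)}, {(v, 4), (v, 3)}, {(v, 4), (v, 5)}}"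
      by simp
    show ?thesis unfolding AB C
      by (intro equalityI; simp only: insert_subset empty_subsetI) (simp_all add: doubleton_eq_iff)
  qed
  have "?h ` truncation G ?V (links (uedges G)) =
    (\<Union>v\<in>?V. (\<lambda>(i, j). {(v, i), (v, j)}) ` ({0, 2, 4 :: nat} \<times> {1, 3, 5 :: nat})) \<union> ?h ` links (uedges G)"
    unfolding truncation_eq_UN image_Un image_UN using h by simp
  also have "(\<Union>v\<in>?V. (\<lambda>(i, j). {(v, i), (v, j)}) ` ({0, 2, 4 :: nat} \<times> {1, 3, 5 :: nat})) =
    {{(v, i), (v, (i + 1) mod 6)} |v i. v \<in> ?V \<and> i < 6} \<union>
    {{(v, i), (v, (i + 3) mod 6)} |v i. v \<in> ?V \<and> i < 6}"
    unfolding hex[symmetric] by auto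
  also have "?h ` links (uedges G) = \<Union> {link_edges idx u v |u v. {u, v} \<in> uedges G}"
  proof -
    have "?h ` links (uedges G) = {{hexX idx (u, v), hexY idx (v, u)} |u v. {u, v} \<in> uedges G}"
      unfolding links_def by auto
    also have "\<dots> = \<Union> {link_edges idx u v |u v. {u, v} \<in> uedges G}"
    \<comment> \<open>The two edges that replace an edge of \<open>G\<close> come from its two
      orientations.\<close>
    proof (intro equalityI subsetI)
      fix e assume "e \<in> \<Union> {link_edges idx u v |u v. {u, v} \<in> uedges G}"
      then obtain u v where uv: "{u, v} \<in> uedges G"
        "e = {hexX idx (u, v), hexY idx (v, u)} \<or> e = {hexX idx (v, u), hexY idx (u, v)}"
        unfolding link_edges_eq by blast
      moreover have "{v, u} \<in> uedges G" using uv(1) by (simp add: insert_commute)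
      ultimately show "e \<in> {{hexX idx (u, v), hexY idx (v, u)} |u v. {u, v} \<in> uedges G}" by blast
    qed (auto simp: link_edges_eq)
    finally show ?thesis .
  qed
  finally have "uedges (hexagon_graph G idx) = ?h ` truncation G ?V (links (uedges G))"
    by (simp add: hexagon_graph_def)
  moreover have "hexX idx ` darts G ?V \<inter> hexY idx ` darts G ?V = {}" unfolding X Y by auto
  ultimately show ?thesis
    unfolding bip_rep_def using hexagon_sides_inj[OF assms] sub V by (intro conjI)
qed

end

theorem theorem7:
  fixes G :: "'a ugraph" and idx :: "'a \<Rightarrow> 'a \<Rightarrow> nat"
  assumes "simple_graph G"
    and "connected_graph G"
    and "cubic_graph G"
    and "bridgeless G"
    and "hexagon_indexing G idx"
  shows "\<exists>(k::nat) (H :: nat \<Rightarrow> nat ugraph).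
           H 0 = L8 \<and>
           (\<forall>i\<in>{0..k}. bipartite_graph (H i)) \<and>
           (\<forall>i\<in>{1..k}. simple_augmentation (H (i - 1)) (H i)) \<and>
           graph_iso (H k) (hexagon_graph G idx)"
proof -
  interpret bridgeless_cubic G using assms(1-4) by unfold_locales
  obtain X f g where X: "reachable X"
    "bip_rep (darts G (uverts G)) (darts G (uverts G)) (truncation G (uverts G) (links (uedges G))) f g X"
    using truncation_generated unfolding generated_def by blast
  have "graph_iso X (hexagon_graph G idx)"
    using bip_rep_iso[OF X(2) hexagon_graph_rep[OF assms(5)]] .
  then show ?thesis using reachable_sequence[OF X(1)] by blast
qed

end
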